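(* Let $\mathcal{A}$ be a contract automaton in the flow setting described in the context. Then $\mathcal{A}$ is weakly safe if and only if the optimal value of the following problem is $\ge 0$: minimise $\gamma$ subject to $\sum_{i\in I_l}v_i\sum_{t_j\in T}a^i_{t_j}x_{t_j}\le\gamma$, $\sum_{i\in I_l}v_i=1$, $v_i\in\{0,1\}$ for all $i\in I_l$, $(x_{t_1},\ldots,x_{t_n})\in F_x$, $\gamma\in\mathbb{R}$.
   Context: Fix disjoint sets $\mathbb{R}$ (requests) and $\mathbb{O}$ (offers $\overline a$) and an idle symbol $\Box$; $\Sigma=\mathbb{R}\cup\mathbb{O}\cup\{\Box\}$, $co$ swaps $a$ and $\overline a$, fixes $\Box$. For $\vec v\in\Sigma^n$, $\vec v_{(i)}$ is its $i$-th entry. $\vec a\in\Sigma^n$ is a request (resp. offer) on $\alpha$ if $\vec a=\Box^{n_1}\alpha\Box^{n_2}$ with $\alpha\in\mathbb{R}$ (resp. $\mathbb{O}$), a match on $\alpha$ if $\vec a=\Box^{n_1}\alpha\Box^{n_2}co(\alpha)\Box^{n_3}$; $\vec a\bowtie\vec b$ iff $\vec a$ is a request or offer on some $\alpha$, and if an offer on $\alpha$ then $\vec b$ is a request on $co(\alpha)$, and if a request on $\alpha$ then $\vec b$ is an offer on $co(\alpha)$. A contract automaton (CA) of rank $r$ is $\langle Q,\vec q_0,A^r,A^o,T,F\rangle$, $Q=Q_1\times\cdots\times Q_r$ finite, $\vec q_0\in Q$, finite $A^r\subseteq\mathbb{R}$, $A^o\subseteq\mathbb{O}$, $F\subseteq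 Q$, $T\subseteq Q\times(A^r\cup A^o\cup\{\Box\})^r\times Q$ with labels requests, offers or matches and $\vec a_{(i)}=\Box\Rightarrow\vec q_{(i)}=\vec q'_{(i)}$. $\mathscr{L}(\mathcal{A})$: words of labels of paths from $\vec q_0$ to $F$. Observable of an action: the unique non-idle entry if it is a request or offer, $\tau$ if it is a match. $\mathfrak{W}$: words $w=\vec a_1\ldots\vec a_m\in(\Sigma^r)^*$, $r>1$, with a function $f:[1..m]\to[1..m]$ total and injective on the indices of request actions of $w$ and with $f(i)=j$ only if $\vec a_i\bowtie\vec a_j$. $\mathcal{A}$ is weakly safe iff $\mathscr{L}(\mathcal{A})\subseteq\mathfrak{W}$. Flow setting: $\mathcal{A}$ has a single final state $\vec q_f\ne\vec q_0$, every state is reachable from $\vec q_0$ and $\vec q_f$ is reachable from every state; $A^r=\{a^i\mid i\in I_l=\{1,\ldots,l\}\}$, $T=\{t_1,\ldots,t_n\}$. $FS(\vec q)$ and $BS(\vec q)$ are the sets of transitions leaving and entering $\vec q$. For states $\vec s,\vec d$, $F_{\vec s,\vec d}$ is the set of $(x_{t_1},\ldots,x_{t_n})\in\mathbb{N}^n$ for which there exist reals $z^{\vec q}_{t_i}$ ($\vec q\in Q$, $\vec q\ne\vec s$, $t_i\in T$) with: for all $\vec q$, $\sum_{t_i\in BS(\vec q)}x_{t_i}-\sum_{t_i\in FS(\vec q)}x_{t_i}$ equals $-1$ if $\vec q=\vec s$, $1$ if $\vec q=\vec d$, $0$ otherwise; for all $\vec q\ne\vec s$ and $t_i$, $0\le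 z^{\vec q}_{t_i}\le x_{t_i}$; for all $\vec q\ne\vec s$ and all $\vec q'$, $\sum_{t_i\in BS(\vec q')}z^{\vec q}_{t_i}-\sum_{t_i\in FS(\vec q')}z^{\vec q}_{t_i}$ equals $-p^{\vec q}$ if $\vec q'=\vec s$, $p^{\vec q}$ if $\vec q'=\vec q$, $0$ otherwise, where $p^{\vec q}=1$ if $\sum_{t_i\in FS(\vec q)}x_{t_i}>0$ and $p^{\vec q}=0$ otherwise. $F_x=F_{\vec q_0,\vec q_f}$. For $t_j=(\vec q,\vec a,\vec q')\in T$ and $i\in I_l$: $a^i_{t_j}=1$ if the observable of $\vec a$ is $\overline{a^i}$, $-1$ if it is $a^i$, and $0$ otherwise. *)

theory Defs
  imports "HOL-Library.Extended_Real" "HOL-Library.FuncSet"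
begin

section \<open>Actions\<close>

text \<open>The alphabet of requests, offers and the idle symbol. The offer on \<open>n\<close> is \<open>Off n\<close>.\<close>

datatype 'n action = Req 'n | Off 'n | Idle

abbreviation Requests :: "'n action set" where
  "Requests \<equiv> range Req"

abbreviation Offers :: "'n action set" where
  "Offers \<equiv> range Off"

fun co :: "'n action \<Rightarrow> 'n action" where
  "co (Req n) = Off n"
| "co (Off n) = Req n"
| "co Idle = Idle"

text \<open>Vectors (of actions or of states) are lists, all of length equal to the rank.\<close>

type_synonym 'n label = "'n action list"

definition request_on :: "'n label \<Rightarrow> 'n action \<Rightarrow> bool" where
  "request_on v \<alpha> \<longleftrightarrow> \<alpha> \<in> Requests \<and>
     (\<exists>n1 n2. v = replicate n1 Idle @ [\<alpha>] @ replicate n2 Idle)"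

definition offer_on :: "'n label \<Rightarrow> 'n action \<Rightarrow> bool" where
  "offer_on v \<alpha> \<longleftrightarrow> \<alpha> \<in> Offers \<and>
     (\<exists>n1 n2. v = replicate n1 Idle @ [\<alpha>] @ replicate n2 Idle)"

text \<open>The action of a match is a request or an offer; the all-idle vector is not a match.\<close>

definition match_on :: "'n label \<Rightarrow> 'n action \<Rightarrow> bool" where
  "match_on v \<alpha> \<longleftrightarrow> \<alpha> \<in> Requests \<union> Offers \<and>
     (\<exists>n1 n2 n3. v = replicate n1 Idle @ [\<alpha>] @ replicate n2 Idle @ [co \<alpha>] @ replicate n3 Idle)"

definition is_request :: "'n label \<Rightarrow> bool" where
  "is_request v \<longleftrightarrow> (\<exists>\<alpha>. request_on v \<alpha>)"

definition is_offer :: "'n label \<Rightarrow> bool" where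
  "is_offer v \<longleftrightarrow> (\<exists>\<alpha>. offer_on v \<alpha>)"

definition is_match :: "'n label \<Rightarrow> bool" where
  "is_match v \<longleftrightarrow> (\<exists>\<alpha>. match_on v \<alpha>)"

definition complementary :: "'n label \<Rightarrow> 'n label \<Rightarrow> bool" (infix "\<bowtie>" 50) where
  "a \<bowtie> b \<longleftrightarrow> (is_request a \<or> is_offer a) \<and>
     (\<forall>\<alpha>. offer_on a \<alpha> \<longrightarrow> request_on b (co \<alpha>)) \<and>
     (\<forall>\<alpha>. request_on a \<alpha> \<longrightarrow> offer_on b (co \<alpha>))"

datatype 'n observable = Tau | Vis "'n action"

text \<open>Only meaningful on requests, offers and matches.\<close>

definition observable_of :: "'n label \<Rightarrow> 'n observable" where
  "observable_of v =
     (if is_match v then Tau else Vis (THE \<alpha>. \<alpha> \<in> set v \<and> \<alpha> \<noteq> Idle))"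


section \<open>Contract automata\<close>

type_synonym ('q, 'n) transition = "'q list \<times> 'n label \<times> 'q list"

record ('q, 'n) ca =
  components :: "'q set list"
  initial :: "'q list"
  requests :: "'n action set"
  offers :: "'n action set"
  transitions :: "('q, 'n) transition set"
  finals :: "'q list set"

definition rank :: "('q, 'n) ca \<Rightarrow> nat" where
  "rank A = length (components A)"

definition states :: "('q, 'n) ca \<Rightarrow> 'q list set" where
  "states A = listset (components A)"

definition contract_automaton :: "('q, 'n) ca \<Rightarrow> bool" where
  "contract_automaton A \<longleftrightarrow>
     finite (states A) \<and>
     initial A \<in> states A \<and>
     finite (requests A) \<and> requests A \<subseteq> Requests \<and>
     finite (offers A) \<and> offers A \<subseteq> Offers \<and>
     finals A \<subseteq> states A \<and>
     (\<forall>(q, a, q') \<in> transitions A.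
        q \<in> states A \<and> q' \<in> states A \<and>
        length a = rank A \<and> set a \<subseteq> requests A \<union> offers A \<union> {Idle} \<and>
        (is_request a \<or> is_offer a \<or> is_match a) \<and>
        (\<forall>i < rank A. a ! i = Idle \<longrightarrow> q ! i = q' ! i))"

inductive path :: "('q, 'n) ca \<Rightarrow> 'q list \<Rightarrow> 'n label list \<Rightarrow> 'q list \<Rightarrow> bool"
  for A :: "('q, 'n) ca" where
  path_Nil: "q \<in> states A \<Longrightarrow> path A q [] q"
| path_Cons: "(q, a, q') \<in> transitions A \<Longrightarrow> path A q' w q'' \<Longrightarrow> path A q (a # w) q''"

definition language :: "('q, 'n) ca \<Rightarrow> 'n label list set" where
  "language A = {w. \<exists>q \<in> finals A. path A (initial A) w q}"

text \<open>Words of rank \<open>r\<close> in weak agreement. The matching \<open>f\<close> is a partial function on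
  positions (counted from 0), defined at least on all request positions.\<close>

definition weak_agreement :: "nat \<Rightarrow> 'n label list set" where
  "weak_agreement r = {w. r > 1 \<and> (\<forall>a \<in> set w. length a = r) \<and>
     (\<exists>f :: nat \<Rightarrow> nat option.
        dom f \<subseteq> {..<length w} \<and> ran f \<subseteq> {..<length w} \<and>
        {i. i < length w \<and> is_request (w ! i)} \<subseteq> dom f \<and>
        inj_on f {i. i < length w \<and> is_request (w ! i)} \<and>
        (\<forall>i j. f i = Some j \<longrightarrow> w ! i \<bowtie> w ! j))}"

definition weakly_safe :: "('q, 'n) ca \<Rightarrow> bool" where
  "weakly_safe A \<longleftrightarrow> language A \<subseteq> weak_agreement (rank A)"


section \<open>Flows\<close>

definition FS :: "('q, 'n) ca \<Rightarrow> 'q list \<Rightarrow> ('q, 'n) transition set" where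
  "FS A q = {t \<in> transitions A. fst t = q}"

definition BS :: "('q, 'n) ca \<Rightarrow> 'q list \<Rightarrow> ('q, 'n) transition set" where
  "BS A q = {t \<in> transitions A. snd (snd t) = q}"

definition net_inflow :: "('q, 'n) ca \<Rightarrow> (('q, 'n) transition \<Rightarrow> real) \<Rightarrow> 'q list \<Rightarrow> real" where
  "net_inflow A y q = (\<Sum>t \<in> BS A q. y t) - (\<Sum>t \<in> FS A q. y t)"

definition active :: "('q, 'n) ca \<Rightarrow> (('q, 'n) transition \<Rightarrow> nat) \<Rightarrow> 'q list \<Rightarrow> real" where
  "active A x q = (if (\<Sum>t \<in> FS A q. x t) > 0 then 1 else 0)"

text \<open>Vectors indexed by the transitions are extensional functions on \<open>transitions A\<close>.\<close>

definition flows :: "('q, 'n) ca \<Rightarrow> 'q list \<Rightarrow> 'q list \<Rightarrow> (('q, 'n) transition \<Rightarrow> nat) set" where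
  "flows A s d = {x \<in> transitions A \<rightarrow>\<^sub>E UNIV.
     \<exists>z :: 'q list \<Rightarrow> ('q, 'n) transition \<Rightarrow> real.
       (\<forall>q \<in> states A. net_inflow A (\<lambda>t. real (x t)) q
            = (if q = s then - 1 else if q = d then 1 else 0)) \<and>
       (\<forall>q \<in> states A - {s}. \<forall>t \<in> transitions A. 0 \<le> z q t \<and> z q t \<le> real (x t)) \<and>
       (\<forall>q \<in> states A - {s}. \<forall>q' \<in> states A. net_inflow A (z q) q'
            = (if q' = s then - active A x q else if q' = q then active A x q else 0))}"

text \<open>The flow setting: \<open>qf\<close> is the single final state and \<open>a 1, \<dots>, a l\<close> enumerate the
  requests.\<close>

definition flow_setting :: "('q, 'n) ca \<Rightarrow> 'q list \<Rightarrow> nat \<Rightarrow> (nat \<Rightarrow> 'n action) \<Rightarrow> bool" where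
  "flow_setting A qf l a \<longleftrightarrow>
     contract_automaton A \<and>
     finals A = {qf} \<and> qf \<noteq> initial A \<and>
     (\<forall>q \<in> states A. \<exists>w. path A (initial A) w q) \<and>
     (\<forall>q \<in> states A. \<exists>w. path A q w qf) \<and>
     requests A = a ` {1..l}"

definition coefficient :: "'n action \<Rightarrow> ('q, 'n) transition \<Rightarrow> real" where
  "coefficient \<alpha> t =
     (case t of (q, b, q') \<Rightarrow>
        if observable_of b = Vis (co \<alpha>) then 1
        else if observable_of b = Vis \<alpha> then - 1
        else 0)"

definition feasible ::
  "('q, 'n) ca \<Rightarrow> 'q list \<Rightarrow> nat \<Rightarrow> (nat \<Rightarrow> 'n action)
    \<Rightarrow> (nat \<Rightarrow> real) \<Rightarrow> (('q, 'n) transition \<Rightarrow> nat) \<Rightarrow> real \<Rightarrow> bool" where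
  "feasible A qf l a v x \<gamma> \<longleftrightarrow>
     (\<Sum>i \<in> {1..l}. v i * (\<Sum>t \<in> transitions A. coefficient (a i) t * real (x t))) \<le> \<gamma> \<and>
     (\<Sum>i \<in> {1..l}. v i) = 1 \<and>
     (\<forall>i \<in> {1..l}. v i \<in> {0, 1}) \<and>
     x \<in> flows A (initial A) qf"

text \<open>The optimal value is an infimum in the extended reals: \<open>\<infinity>\<close> if the problem is infeasible
  (which happens when \<open>l = 0\<close>), \<open>-\<infinity>\<close> if it is unbounded.\<close>

definition optimal_value :: "('q, 'n) ca \<Rightarrow> 'q list \<Rightarrow> nat \<Rightarrow> (nat \<Rightarrow> 'n action) \<Rightarrow> ereal" where
  "optimal_value A qf l a = Inf {ereal \<gamma> |\<gamma>. \<exists>v x. feasible A qf l a v x \<gamma>}"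

end

theory Submission
  imports Defs "HOL-Library.Multiset"
begin

text \<open>The flows from the initial to the final state are exactly the transition counts of accepting
  runs: the balance equations are Euler's condition for a trail, and the auxiliary flows \<open>z\<close> force
  the support to be reachable, so that a trail can be enlarged by closed walks until it uses up the
  whole flow. A word is in weak agreement iff, for every name, it has at least as many offers as
  requests, because only offers on the same name can serve a request. The sum of the coefficients
  along a run is the surplus of offers, and the 0/1 vector \<open>v\<close> just selects one request.\<close>

section \<open>Eulerian trails in directed multigraphs\<close>

text \<open>A walk lists whole edges rather than labels, so that \<open>mset p\<close> records how
  often each transition is taken.\<close>

fun walk :: "'v \<Rightarrow> ('v \<times> 'l \<times> 'v) list \<Rightarrow> 'v \<Rightarrow> bool" where
  "walk u [] v \<longleftrightarrow> u = v"
| "walk u (e # p) v \<longleftrightarrow> fst e = u \<and> walk (snd (snd e)) p v"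

lemma walk_append: "walk u (p @ q) v \<longleftrightarrow> (\<exists>w. walk u p w \<and> walk w q v)"
  by (induction p arbitrary: u) auto

definition outdeg :: "('v \<times> 'l \<times> 'v) multiset \<Rightarrow> 'v \<Rightarrow> nat" where
  "outdeg M v = size {#e \<in># M. fst e = v#}"

definition indeg :: "('v \<times> 'l \<times> 'v) multiset \<Rightarrow> 'v \<Rightarrow> nat" where
  "indeg M v = size {#e \<in># M. snd (snd e) = v#}"

lemma degree_simps [simp]:
  "outdeg {#} v = 0" "indeg {#} v = 0"
  "outdeg (add_mset e M) v = outdeg M v + of_bool (fst e = v)"
  "indeg (add_mset e M) v = indeg M v + of_bool (snd (snd e) = v)"
  "outdeg (M + N) v = outdeg M v + outdeg N v"
  "indeg (M + N) v = indeg M v + indeg N v"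
  by (auto simp: outdeg_def indeg_def)

lemma outdeg_pos_iff: "outdeg M v > 0 \<longleftrightarrow> (\<exists>e. e \<in># M \<and> fst e = v)"
  by (induction M) auto

text \<open>For \<open>u = v\<close> this describes a circulation.\<close>

definition unit_flow :: "('v \<times> 'l \<times> 'v) multiset \<Rightarrow> 'v \<Rightarrow> 'v \<Rightarrow> bool" where
  "unit_flow M u v \<longleftrightarrow> (\<forall>w. outdeg M w + of_bool (w = v) = indeg M w + of_bool (w = u))"

lemma walk_unit_flow: "walk u p v \<Longrightarrow> unit_flow (mset p) u v"
proof (induction p arbitrary: u)
  case (Cons e p)
  then have "unit_flow (mset p) (snd (snd e)) v" by simp
  then have IH: "outdeg (mset p) w + of_bool (w = v) = indeg (mset p) w + of_bool (w = snd (snd e))" for w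
    by (auto simp: unit_flow_def)
  have "u = fst e" using Cons.prems by simp
  then show ?case unfolding unit_flow_def
    using IH by (simp add: eq_commute[of "fst e"] eq_commute[of "snd (snd e)"])
qed (simp add: unit_flow_def)

text \<open>Greedy descent: deleting an outgoing edge of \<open>u\<close> leaves a unit flow from
  the head of that edge to \<open>v\<close>, and the walk can only get stuck at \<open>v\<close>.
  The last conjunct matters when \<open>u = v\<close>, where the empty walk would otherwise be an
  answer.\<close>

lemma unit_flow_imp_walk:
  assumes "unit_flow M u v"
  shows "\<exists>p. walk u p v \<and> mset p \<subseteq># M \<and> (outdeg M u > 0 \<longrightarrow> p \<noteq> [])"
  using assms
proof (induction "size M" arbitrary: M u rule: less_induct)
  case less
  show ?case
  proof (cases "outdeg M u = 0")
    case True
    \<comment> \<open>With no outgoing edge at \<open>u\<close>, the balance there reads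
      \<open>of_bool (u = v) = indeg M u + 1\<close>.\<close>
    then have "u = v"
      using less.prems[unfolded unit_flow_def, rule_format, of u] by (auto simp: of_bool_def split: if_splits)
    then show ?thesis using True by (intro exI[of _ "[]"]) auto
  next
    case False
    then obtain e where e: "e \<in># M" "fst e = u"
      using outdeg_pos_iff[of M u] by auto
    define N where "N = M - {#e#}"
    have M: "M = add_mset e N" using e N_def by simp
    have "unit_flow N (snd (snd e)) v"
      unfolding unit_flow_def
    proof
      fix w
      show "outdeg N w + of_bool (w = v) = indeg N w + of_bool (w = snd (snd e))"
        using less.prems[unfolded unit_flow_def M, rule_format, of w] e(2)
        by (auto simp: of_bool_def split: if_splits)
    qed
    then obtain p where p: "walk (snd (snd e)) p v" "mset p \<subseteq># N"
      using less.hyps[of N] M by auto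
    then show ?thesis using e(2) M by (intro exI[of _ "e # p"]) auto
  qed
qed

lemma residual_edge_on_walk:
  assumes p: "walk u p v"
    and conn: "\<And>e. e \<in># M \<Longrightarrow> \<exists>q. walk u q (fst e) \<and> set q \<subseteq> set_mset M"
    and ne: "M - mset p \<noteq> {#}"
  shows "\<exists>e p1 p2. e \<in># M - mset p \<and> p = p1 @ p2 \<and> walk u p1 (fst e) \<and> walk (fst e) p2 v"
proof -
  define on where "on w \<longleftrightarrow> (\<exists>p1 p2. p = p1 @ p2 \<and> walk u p1 w \<and> walk w p2 v)" for w
  have on_u: "on u" unfolding on_def using p by (intro exI[of _ "[]"] exI[of _ p]) auto
  have on_set: "on (snd (snd e))" if e: "e \<in> set p" for e
  proof -
    obtain p1 p2 where "p = p1 @ e # p2" using e by (auto dest: split_list)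
    then have "p = (p1 @ [e]) @ p2 \<and> walk u (p1 @ [e]) (snd (snd e)) \<and> walk (snd (snd e)) p2 v"
      using p by (auto simp: walk_append)
    then show ?thesis unfolding on_def by blast
  qed
  have "on w \<or> (\<exists>e. e \<in># M - mset p \<and> on (fst e))"
    if "walk u q w" "set q \<subseteq> set_mset M" for q w
    using that
  proof (induction q arbitrary: w rule: rev_induct)
    case Nil
    then show ?case using on_u by simp
  next
    case (snoc e q)
    then have *: "on (fst e) \<or> (\<exists>e. e \<in># M - mset p \<and> on (fst e))" "w = snd (snd e)" "e \<in># M"
      by (auto simp: walk_append)
    show ?case
    proof (cases "e \<in># M - mset p")
      case False
      \<comment> \<open>No copy of \<open>e\<close> is left over, so \<open>p\<close> itself
        traverses \<open>e\<close> and visits its head.\<close>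
      then have "e \<in> set p" using *(3)
        by (metis count_diff count_greater_zero_iff diff_zero not_in_iff set_mset_mset)
      then show ?thesis using on_set *(2) by blast
    qed (use * in blast)
  qed
  moreover obtain e where e: "e \<in># M - mset p" using ne by blast
  moreover obtain q where "walk u q (fst e)" "set q \<subseteq> set_mset M"
    using conn e by (meson in_diffD)
  ultimately show ?thesis unfolding on_def by blast
qed

lemma walk_extends_to_Eulerian:
  assumes M: "unit_flow M u v"
    and conn: "\<And>e. e \<in># M \<Longrightarrow> \<exists>q. walk u q (fst e) \<and> set q \<subseteq> set_mset M"
    and p: "walk u p v" "mset p \<subseteq># M"
  shows "\<exists>q. walk u q v \<and> mset q = M"
  using p
proof (induction "size M - length p" arbitrary: p rule: less_induct)
  case less
  show ?case
  proof (cases "M - mset p = {#}")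
    case True
    then show ?thesis using less.prems
      by (metis subset_mset.diff_add add_0)
  next
    case False
    then obtain e p1 p2 where e: "e \<in># M - mset p" "p = p1 @ p2" "walk u p1 (fst e)" "walk (fst e) p2 v"
      using residual_edge_on_walk[OF less.prems(1) conn] by blast
    define R where "R = M - mset p"
    have MR: "M = R + mset p" using less.prems(2) R_def by simp
    \<comment> \<open>\<open>M\<close> and \<open>p\<close> have the same imbalance at
      \<open>u\<close> and \<open>v\<close>; subtracting one from the other leaves every vertex
      balanced.\<close>
    have "unit_flow R (fst e) (fst e)"
      unfolding unit_flow_def
    proof
      fix w
      show "outdeg R w + of_bool (w = fst e) = indeg R w + of_bool (w = fst e)"
        using M[unfolded unit_flow_def MR, rule_format, of w]
          walk_unit_flow[OF less.prems(1), unfolded unit_flow_def, rule_format, of w]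
        by simp
    qed
    moreover have "outdeg R (fst e) > 0"
      using e(1) unfolding outdeg_pos_iff R_def by blast
    ultimately obtain c where c: "walk (fst e) c (fst e)" "mset c \<subseteq># R" "c \<noteq> []"
      using unit_flow_imp_walk[of R "fst e" "fst e"] by auto
    define p' where "p' = p1 @ c @ p2"
    have w: "walk u p' v" using e c by (auto simp: p'_def walk_append)
    have sub: "mset p' \<subseteq># M"
      using c(2) unfolding MR p'_def e(2) by (simp add: ac_simps)
    \<comment> \<open>The measure is a truncated subtraction, so a longer walk decreases it strictly
      only because it still fits into \<open>M\<close>.\<close>
    have "length p' \<le> size M" using size_mset_mono[OF sub] by simp
    moreover have "length p < length p'" using c(3) e(2) by (simp add: p'_def)
    ultimately have "size M - length p' < size M - length p" by linarith
    from less.hyps[OF this w sub] show ?thesis .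
  qed
qed

text \<open>Balance alone would allow circulations detached from the walk; reachability of every
  edge source from \<open>u\<close> inside the support excludes them.\<close>

theorem unit_flow_Eulerian:
  assumes "unit_flow M u v"
    and "\<And>e. e \<in># M \<Longrightarrow> \<exists>q. walk u q (fst e) \<and> set q \<subseteq> set_mset M"
  shows "\<exists>p. walk u p v \<and> mset p = M"
  using unit_flow_imp_walk[OF assms(1)] walk_extends_to_Eulerian[OF assms] by blast

section \<open>Flows of a contract automaton\<close>

lemma contract_automatonD:
  assumes "contract_automaton A" "t \<in> transitions A"
  shows "fst t \<in> states A" "snd (snd t) \<in> states A" "length (fst (snd t)) = rank A"
    "set (fst (snd t)) \<subseteq> requests A \<union> offers A \<union> {Idle}"
    "is_request (fst (snd t)) \<or> is_offer (fst (snd t)) \<or> is_match (fst (snd t))"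
  using assms unfolding contract_automaton_def by (cases t; fastforce)+

lemma finite_transitions:
  assumes "contract_automaton A"
  shows "finite (transitions A)"
proof (rule finite_subset)
  let ?L = "{w. set w \<subseteq> requests A \<union> offers A \<union> {Idle} \<and> length w = rank A}"
  show "transitions A \<subseteq> states A \<times> ?L \<times> states A"
  proof
    fix t assume "t \<in> transitions A"
    from contract_automatonD[OF assms this] show "t \<in> states A \<times> ?L \<times> states A"
      by (cases t) auto
  qed
  have "finite ?L" using assms unfolding contract_automaton_def
    by (intro finite_lists_length_eq) auto
  then show "finite (states A \<times> ?L \<times> states A)"
    using assms unfolding contract_automaton_def by auto
qed

section \<open>Balance equations expressed by degrees\<close>

lemma size_filter_mset_eq_sum:
  assumes "finite T" "set_mset M \<subseteq> T"
  shows "size {#e \<in># M. P e#} = (\<Sum>t \<in> {t \<in> T. P t}. count M t)"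
proof -
  have "(\<Sum>t \<in> {t \<in> T. P t}. count M t) = (\<Sum>t \<in> set_mset {#e \<in># M. P e#}. count M t)"
    using assms by (intro sum.mono_neutral_right) (auto simp: not_in_iff)
  then show ?thesis unfolding size_multiset_overloaded_eq by simp
qed

lemma degree_eq_sum:
  assumes "finite (transitions A)" "set_mset M \<subseteq> transitions A"
  shows "outdeg M q = (\<Sum>t \<in> FS A q. count M t)" "indeg M q = (\<Sum>t \<in> BS A q. count M t)"
  unfolding outdeg_def indeg_def FS_def BS_def
  by (rule size_filter_mset_eq_sum[OF assms])+

lemma net_inflow_count:
  assumes "finite (transitions A)" "set_mset M \<subseteq> transitions A"
  shows "net_inflow A (\<lambda>t. real (count M t)) q = real (indeg M q) - real (outdeg M q)"
  unfolding net_inflow_def degree_eq_sum[OF assms] by simp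

lemma unit_flow_net_inflow:
  assumes "finite (transitions A)" "set_mset M \<subseteq> transitions A" "unit_flow M s d" "s \<noteq> d"
  shows "net_inflow A (\<lambda>t. real (count M t)) q = (if q = s then - 1 else if q = d then 1 else 0)"
proof -
  have "outdeg M q + of_bool (q = d) = indeg M q + of_bool (q = s)"
    using assms(3) by (auto simp: unit_flow_def)
  then have "real (outdeg M q) + of_bool (q = d) = real (indeg M q) + of_bool (q = s)"
    by (metis of_nat_add of_nat_of_bool)
  then show ?thesis using assms(4) unfolding net_inflow_count[OF assms(1,2)]
    by (auto split: if_splits)
qed

lemma net_inflow_cong:
  assumes "\<And>t. t \<in> transitions A \<Longrightarrow> y t = y' t"
  shows "net_inflow A y q = net_inflow A y' q"
  unfolding net_inflow_def FS_def BS_def using assms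
  by (intro arg_cong2[where f = "(-)"] sum.cong) auto

text \<open>All balance equations come from \<open>walk_unit_flow\<close>: applied to
  \<open>p\<close> it gives those of \<open>x\<close>, applied to prefixes of \<open>p\<close> those
  of the auxiliary flows, which stay below \<open>x\<close> because a prefix uses no edge more often
  than \<open>p\<close>.\<close>

lemma walk_in_flows:
  assumes CA: "contract_automaton A" and p: "walk s p d" "set p \<subseteq> transitions A" and "s \<noteq> d"
  shows "restrict (count (mset p)) (transitions A) \<in> flows A s d"
proof -
  note fin = finite_transitions[OF CA]
  let ?x = "restrict (count (mset p)) (transitions A)"
  have x: "net_inflow A (\<lambda>t. real (?x t)) q = (if q = s then - 1 else if q = d then 1 else 0)" for q
    using unit_flow_net_inflow[OF fin _ walk_unit_flow[OF p(1)] \<open>s \<noteq> d\<close>, of q] p(2)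
    by (subst net_inflow_cong[where y' = "\<lambda>t. real (count (mset p) t)"]) auto
  \<comment> \<open>The prefix of the walk up to a visited state is the auxiliary flow towards that state.\<close>
  have "\<exists>p1. mset p1 \<subseteq># mset p \<and> walk s p1 q" if "active A ?x q = 1" for q
  proof -
    have "(\<Sum>t \<in> FS A q. ?x t) \<noteq> 0" using that by (auto simp: active_def split: if_splits)
    then obtain e where e: "e \<in> FS A q" "?x e \<noteq> 0" by (meson sum.not_neutral_contains_not_neutral)
    then have "e \<in># mset p" "fst e = q" by (auto simp: FS_def split: if_splits)
    then obtain p1 p2 where "p = p1 @ e # p2" by (auto dest: split_list)
    then show ?thesis using p(1) \<open>fst e = q\<close> by (intro exI[of _ p1]) (auto simp: walk_append)
  qed
  then obtain pr where pr: "mset (pr q) \<subseteq># mset p" "walk s (pr q) q" if "active A ?x q = 1" for q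
    by metis
  \<comment> \<open>At an inactive \<open>q\<close> the prescribed value is 0, so the zero flow
    serves; \<open>pr q\<close> is constrained only at active states.\<close>
  define z where "z q t = (if active A ?x q = 1 then real (count (mset (pr q)) t) else 0)" for q t
  have "0 \<le> z q t \<and> z q t \<le> real (?x t)" if "t \<in> transitions A" for q t
    using pr(1)[of q] that by (auto simp: z_def mset_subset_eq_count)
  moreover have "net_inflow A (z q) q' = (if q' = s then - active A ?x q else if q' = q then active A ?x q else 0)"
    if "q \<noteq> s" for q q'
  proof (cases "active A ?x q = 1")
    case True
    have "set_mset (mset (pr q)) \<subseteq> transitions A"
      using set_mset_mono[OF pr(1)[OF True]] p(2) by auto
    from unit_flow_net_inflow[OF fin this walk_unit_flow[OF pr(2)[OF True]], of q'] that
    moreover have "z q = (\<lambda>t. real (count (mset (pr q)) t))"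
      using True by (simp add: z_def fun_eq_iff)
    ultimately show ?thesis using True by simp
  next
    case False
    then have "active A ?x q = 0" unfolding active_def by presburger
    then show ?thesis by (simp add: z_def net_inflow_def)
  qed
  ultimately show ?thesis unfolding flows_def using x by (auto intro!: exI[of _ z] simp del: restrict_apply)
qed

section \<open>From a flow back to a walk\<close>

text \<open>Exchanging the two sums cancels each transition with both ends in \<open>R\<close>, so
  only transitions crossing the boundary of \<open>R\<close> contribute.\<close>

lemma sum_net_inflow:
  assumes "finite (transitions A)" "finite R"
  shows "(\<Sum>q \<in> R. net_inflow A z q) =
    (\<Sum>t \<in> transitions A. z t * (of_bool (snd (snd t) \<in> R) - of_bool (fst t \<in> R)))"
proof -
  have "net_inflow A z q = (\<Sum>t \<in> transitions A. z t * (of_bool (snd (snd t) = q) - of_bool (fst t = q)))" for q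
    unfolding net_inflow_def FS_def BS_def sum.inter_filter[OF assms(1)] sum_subtractf[symmetric]
    by (intro sum.cong) auto
  then have "(\<Sum>q \<in> R. net_inflow A z q) =
      (\<Sum>t \<in> transitions A. \<Sum>q \<in> R. z t * (of_bool (snd (snd t) = q) - of_bool (fst t = q)))"
    using sum.swap by simp
  also have "\<dots> = (\<Sum>t \<in> transitions A. z t * (of_bool (snd (snd t) \<in> R) - of_bool (fst t \<in> R)))"
    by (intro sum.cong refl, subst sum_distrib_left[symmetric])
      (simp add: sum_subtractf of_bool_def assms(2))
  finally show ?thesis .
qed

text \<open>No unit of flow could leave the set of states reachable along the support of \<open>x\<close>.\<close>

lemma flow_imp_reachable:
  assumes CA: "contract_automaton A" and s: "s \<in> states A" and q: "q \<in> states A"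
    and z: "\<And>t. t \<in> transitions A \<Longrightarrow> 0 \<le> z t \<and> z t \<le> real (x t)"
    and net: "\<And>q'. q' \<in> states A \<Longrightarrow>
      net_inflow A z q' = (if q' = s then - 1 else if q' = q then 1 else 0)"
  shows "\<exists>p. walk s p q \<and> set p \<subseteq> {t \<in> transitions A. x t > 0}"
proof (rule ccontr)
  assume unreachable: "\<not> ?thesis"
  define R where "R = {q' \<in> states A. \<exists>p. walk s p q' \<and> set p \<subseteq> {t \<in> transitions A. x t > 0}}"
  have R: "finite R" "s \<in> R" "q \<notin> R" "R \<subseteq> states A"
    using CA s unreachable unfolding R_def contract_automaton_def
    by (auto intro: exI[of _ "[]"])
  \<comment> \<open>\<open>R\<close> contains the source of the unit flow but not its sink, so its
    total net inflow is -1; the boundary terms will be shown nonnegative.\<close>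
  have "(\<Sum>q' \<in> R. net_inflow A z q') = (\<Sum>q' \<in> R. if q' = s then - 1 else 0)"
    using R net by (intro sum.cong) auto
  then have "(\<Sum>q' \<in> R. net_inflow A z q') = - 1" using R by simp
  moreover have "0 \<le> z t * (of_bool (snd (snd t) \<in> R) - of_bool (fst t \<in> R))"
    if t: "t \<in> transitions A" for t
  proof (cases "fst t \<in> R \<and> x t > 0")
    case True
    then obtain p where "walk s p (fst t)" "set p \<subseteq> {t \<in> transitions A. x t > 0}"
      by (auto simp: R_def)
    then have "walk s (p @ [t]) (snd (snd t)) \<and> set (p @ [t]) \<subseteq> {t \<in> transitions A. x t > 0}"
      using t True by (auto simp: walk_append)
    then have "snd (snd t) \<in> R" unfolding R_def using contract_automatonD(2)[OF CA t] by blast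
    then show ?thesis using z[OF t] by auto
  next
    case False
    \<comment> \<open>Either \<open>t\<close> does not start in \<open>R\<close>, and the factor is
      nonnegative, or \<open>x t = 0\<close>, which forces \<open>z t = 0\<close>.\<close>
    then show ?thesis using z[OF t] by auto
  qed
  ultimately show False
    using sum_net_inflow[OF finite_transitions[OF CA] R(1), of z]
      sum_nonneg[of "transitions A" "\<lambda>t. z t * (of_bool (snd (snd t) \<in> R) - of_bool (fst t \<in> R))"]
    by simp
qed

text \<open>Read \<open>x\<close> as a multiset \<open>M\<close> of transitions. Its balance makes
  \<open>M\<close> a unit flow, the auxiliary flows make its support reachable from
  \<open>s\<close>, and an Eulerian walk then uses every transition exactly \<open>x t\<close>
  times.\<close>

lemma flows_imp_walk:
  assumes CA: "contract_automaton A" and s: "s \<in> states A" and d: "d \<in> states A" "s \<noteq> d"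
    and x: "x \<in> flows A s d"
  shows "\<exists>p. walk s p d \<and> set p \<subseteq> transitions A \<and> x = restrict (count (mset p)) (transitions A)"
proof -
  note fin = finite_transitions[OF CA]
  from x obtain z where x_ext: "x \<in> transitions A \<rightarrow>\<^sub>E UNIV"
    and net: "\<And>q. q \<in> states A \<Longrightarrow> net_inflow A (\<lambda>t. real (x t)) q
            = (if q = s then - 1 else if q = d then 1 else 0)"
    and z: "\<And>q t. q \<in> states A \<Longrightarrow> q \<noteq> s \<Longrightarrow> t \<in> transitions A \<Longrightarrow> 0 \<le> z q t \<and> z q t \<le> real (x t)"
    and netz: "\<And>q q'. q \<in> states A \<Longrightarrow> q \<noteq> s \<Longrightarrow> q' \<in> states A \<Longrightarrow> net_inflow A (z q) q'
            = (if q' = s then - active A x q else if q' = q then active A x q else 0)"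
    unfolding flows_def by auto blast
  define M where "M = (\<Sum>t \<in> transitions A. replicate_mset (x t) t)"
  have cM: "count M t = (if t \<in> transitions A then x t else 0)" for t
    unfolding M_def using fin by (simp add: count_sum)
  have MT: "set_mset M = {t \<in> transitions A. x t > 0}"
    by (auto simp: cM simp flip: count_greater_zero_iff split: if_splits)
  then have sub: "set_mset M \<subseteq> transitions A" by auto
  have "unit_flow M s d"
    unfolding unit_flow_def
  proof
    fix w
    show "outdeg M w + of_bool (w = d) = indeg M w + of_bool (w = s)"
    proof (cases "w \<in> states A")
      case True
      have "real (indeg M w) - real (outdeg M w) = (if w = s then - 1 else if w = d then 1 else 0)"
        unfolding net_inflow_count[OF fin sub, symmetric] net[OF True, symmetric]
        by (intro net_inflow_cong) (simp add: cM)
      then show ?thesis using d(2) by (auto split: if_splits)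
    next
      case False
      \<comment> \<open>\<open>unit_flow\<close> speaks of all vertices of the type; outside the
        states there are no transitions to count.\<close>
      then have "FS A w = {}" "BS A w = {}"
        using contract_automatonD(1,2)[OF CA] by (auto simp: FS_def BS_def)
      then show ?thesis using degree_eq_sum[OF fin sub, of w] False s d by auto
    qed
  qed
  moreover have "\<exists>q. walk s q (fst e) \<and> set q \<subseteq> set_mset M" if "e \<in># M" for e
  proof (cases "fst e = s")
    case True
    \<comment> \<open>There is no auxiliary flow towards \<open>s\<close> itself, but the empty walk
      already reaches it.\<close>
    then show ?thesis by (intro exI[of _ "[]"]) auto
  next
    case False
    have e: "e \<in> transitions A" "x e > 0" using that MT by auto
    have "e \<in> FS A (fst e)" "finite (FS A (fst e))" using e fin by (auto simp: FS_def)
    \<comment> \<open>The used edge \<open>e\<close> makes its own source active, so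
      \<open>z (fst e)\<close> carries one full unit from \<open>s\<close> to that state.\<close>
    then have "(\<Sum>t \<in> FS A (fst e). x t) > 0" using e(2) by (meson sum_pos2 zero_le)
    then have act: "active A x (fst e) = 1" by (simp add: active_def)
    note fe = contract_automatonD(1)[OF CA e(1)]
    show ?thesis unfolding MT
      by (rule flow_imp_reachable[OF CA s fe z[OF fe False]]) (use netz[OF fe False] act in auto)
  qed
  ultimately obtain p where p: "walk s p d" "mset p = M"
    using unit_flow_Eulerian[of M s d] by auto
  have "x = restrict (count (mset p)) (transitions A)"
    using x_ext unfolding p(2) by (intro ext) (auto simp: cM PiE_def extensional_def restrict_def)
  moreover have "set p \<subseteq> transitions A" using p(2) sub by (metis set_mset_mset)
  ultimately show ?thesis using p(1) by blast
qed

section \<open>Paths of the automaton as walks\<close>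

lemma path_imp_walk:
  "path A q w q' \<Longrightarrow> \<exists>p. walk q p q' \<and> set p \<subseteq> transitions A \<and> w = map (fst \<circ> snd) p"
proof (induction rule: path.induct)
  case (path_Nil q)
  show ?case by (intro exI[of _ "[]"]) auto
next
  case (path_Cons q a q' w q'')
  then obtain p where "walk q' p q''" "set p \<subseteq> transitions A" "w = map (fst \<circ> snd) p" by blast
  then show ?case using path_Cons.hyps(1) by (intro exI[of _ "(q, a, q') # p"]) auto
qed

lemma walk_imp_path:
  assumes "q' \<in> states A"
  shows "walk q p q' \<Longrightarrow> set p \<subseteq> transitions A \<Longrightarrow> path A q (map (fst \<circ> snd) p) q'"
proof (induction p arbitrary: q)
  case Nil
  then show ?case using assms by (auto intro: path.intros)
next
  case (Cons e p)
  then show ?case by (cases e) (auto intro: path.intros)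
qed

section \<open>Weak agreement as a counting condition\<close>

text \<open>The list of non-idle entries forgets the padding but still determines the action of a
  label; its length separates matches from requests and offers.\<close>

lemma filter_request:
  assumes "request_on v \<alpha>"
  shows "filter (\<lambda>x. x \<noteq> Idle) v = [\<alpha>]"
  using assms by (auto simp: request_on_def)

lemma filter_offer:
  assumes "offer_on v \<alpha>"
  shows "filter (\<lambda>x. x \<noteq> Idle) v = [\<alpha>]"
  using assms by (auto simp: offer_on_def)

lemma filter_match:
  assumes "match_on v \<alpha>"
  shows "filter (\<lambda>x. x \<noteq> Idle) v = [\<alpha>, co \<alpha>]"
  using assms by (auto simp: match_on_def)

lemma request_on_unique: "request_on v \<alpha> \<Longrightarrow> request_on v \<beta> \<Longrightarrow> \<alpha> = \<beta>"
  by (drule filter_request)+ simp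

lemma request_not_offer: "request_on v \<alpha> \<Longrightarrow> \<not> offer_on v \<beta>"
  using filter_request[of v \<alpha>] filter_offer[of v \<beta>] by (auto simp: request_on_def offer_on_def)

lemma observable_singleton:
  assumes "filter (\<lambda>x. x \<noteq> Idle) v = [\<alpha>]"
  shows "observable_of v = Vis \<alpha>"
proof -
  have "\<not> is_match v" using assms filter_match by (fastforce simp: is_match_def)
  moreover have "\<beta> \<in> set v \<and> \<beta> \<noteq> Idle \<longleftrightarrow> \<beta> = \<alpha>" for \<beta>
    using arg_cong[OF assms, of set] by auto
  ultimately show ?thesis by (simp add: observable_of_def)
qed

text \<open>The hypothesis excludes malformed labels such as one with \<open>Req n\<close> in two
  positions, on which \<open>observable_of\<close> would also yield
  \<open>Vis (Req n)\<close>.\<close>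

lemma observable_Req_iff:
  assumes "is_request v \<or> is_offer v \<or> is_match v"
  shows "observable_of v = Vis (Req n) \<longleftrightarrow> request_on v (Req n)"
proof
  assume obs: "observable_of v = Vis (Req n)"
  then have "\<not> is_match v" by (auto simp: observable_of_def)
  then consider \<alpha> where "request_on v \<alpha>" | \<alpha> where "offer_on v \<alpha>"
    using assms by (auto simp: is_request_def is_offer_def)
  then show "request_on v (Req n)"
  proof cases
    case 1
    then show ?thesis using obs observable_singleton[OF filter_request[OF 1]] by (auto simp: request_on_def)
  next
    case 2
    then show ?thesis using obs observable_singleton[OF filter_offer[OF 2]] by (auto simp: offer_on_def)
  qed
qed (use observable_singleton[OF filter_request] in auto)

lemma observable_Off_iff:
  assumes "is_request v \<or> is_offer v \<or> is_match v"
  shows "observable_of v = Vis (Off n) \<longleftrightarrow> offer_on v (Off n)"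
proof
  assume obs: "observable_of v = Vis (Off n)"
  then have "\<not> is_match v" by (auto simp: observable_of_def)
  then consider \<alpha> where "request_on v \<alpha>" | \<alpha> where "offer_on v \<alpha>"
    using assms by (auto simp: is_request_def is_offer_def)
  then show "offer_on v (Off n)"
  proof cases
    case 1
    then show ?thesis using obs observable_singleton[OF filter_request[OF 1]] by (auto simp: request_on_def)
  next
    case 2
    then show ?thesis using obs observable_singleton[OF filter_offer[OF 2]] by (auto simp: offer_on_def)
  qed
qed (use observable_singleton[OF filter_offer] in auto)

section \<open>Matchings and counting per name\<close>

definition request_positions :: "'n label list \<Rightarrow> 'n \<Rightarrow> nat set" where
  "request_positions w n = {i. i < length w \<and> request_on (w ! i) (Req n)}"

definition offer_positions :: "'n label list \<Rightarrow> 'n \<Rightarrow> nat set" where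
  "offer_positions w n = {i. i < length w \<and> offer_on (w ! i) (Off n)}"

lemma finite_positions [simp]: "finite (request_positions w n)" "finite (offer_positions w n)"
  by (auto simp: request_positions_def offer_positions_def)

lemma is_request_iff: "is_request v \<longleftrightarrow> (\<exists>n. request_on v (Req n))"
  by (auto simp: is_request_def request_on_def)

lemma complementary_request_iff:
  assumes "request_on v (Req n)"
  shows "v \<bowtie> u \<longleftrightarrow> offer_on u (Off n)"
proof -
  have "request_on v \<alpha> \<longleftrightarrow> \<alpha> = Req n" for \<alpha>
    using assms request_on_unique[OF assms, of \<alpha>] by auto
  moreover have "\<not> offer_on v \<alpha>" for \<alpha>
    using request_not_offer[OF assms] .
  ultimately show ?thesis by (simp add: complementary_def is_request_def)
qed

text \<open>A request on \<open>n\<close> can only be served by an offer on \<open>n\<close>, so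
  \<open>f\<close> restricts to an injection between the positions for each name. Conversely,
  injections chosen name by name glue together, since one position cannot hold offers on two
  names.\<close>

lemma weak_agreement_iff:
  assumes "r > 1" "\<forall>v \<in> set w. length v = r"
  shows "w \<in> weak_agreement r \<longleftrightarrow>
    (\<forall>n. card (request_positions w n) \<le> card (offer_positions w n))"
proof
  assume "w \<in> weak_agreement r"
  then obtain f :: "nat \<Rightarrow> nat option" where
    f: "ran f \<subseteq> {..<length w}" "{i. i < length w \<and> is_request (w ! i)} \<subseteq> dom f"
      "inj_on f {i. i < length w \<and> is_request (w ! i)}" "\<forall>i j. f i = Some j \<longrightarrow> w ! i \<bowtie> w ! j"
    unfolding weak_agreement_def by auto
  show "\<forall>n. card (request_positions w n) \<le> card (offer_positions w n)"
  proof
    fix n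
    have sub: "request_positions w n \<subseteq> {i. i < length w \<and> is_request (w ! i)}"
      by (auto simp: request_positions_def is_request_iff)
    have "inj_on (the \<circ> f) (request_positions w n)"
    proof (rule inj_onI)
      fix i j assume ij: "i \<in> request_positions w n" "j \<in> request_positions w n"
        and "(the \<circ> f) i = (the \<circ> f) j"
      moreover have "i \<in> dom f" "j \<in> dom f" using ij sub f(2) by blast+
      ultimately have "f i = f j" by auto
      then show "i = j" using inj_onD[OF f(3)] ij sub by blast
    qed
    moreover have "(the \<circ> f) ` request_positions w n \<subseteq> offer_positions w n"
    proof
      fix k assume "k \<in> (the \<circ> f) ` request_positions w n"
      then obtain i where i: "i \<in> request_positions w n" "k = the (f i)" by auto
      then have "f i = Some k" using sub f(2) by fastforce
      then have "w ! i \<bowtie> w ! k" "k < length w" using f(1,4) by (auto intro: ranI)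
      then show "k \<in> offer_positions w n"
        using i complementary_request_iff[of "w ! i" n]
        by (auto simp: request_positions_def offer_positions_def)
    qed
    ultimately show "card (request_positions w n) \<le> card (offer_positions w n)"
      by (meson card_inj_on_le finite_positions)
  qed
next
  assume "\<forall>n. card (request_positions w n) \<le> card (offer_positions w n)"
  then have "\<exists>g. g ` request_positions w n \<subseteq> offer_positions w n \<and> inj_on g (request_positions w n)" for n
    by (meson card_le_inj finite_positions)
  then obtain g where g: "\<And>n. g n ` request_positions w n \<subseteq> offer_positions w n"
    "\<And>n. inj_on (g n) (request_positions w n)" by metis
  define nm where "nm i = (SOME n. request_on (w ! i) (Req n))" for i
  let ?D = "{i. i < length w \<and> is_request (w ! i)}"
  have nm: "request_on (w ! i) (Req (nm i))" "i \<in> request_positions w (nm i)" if "i \<in> ?D" for i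
  proof -
    show "request_on (w ! i) (Req (nm i))" using that unfolding nm_def
      by (auto simp: is_request_iff intro: someI)
    then show "i \<in> request_positions w (nm i)" using that by (simp add: request_positions_def)
  qed
  \<comment> \<open>The matching must be total on request positions only, so every other position
    may stay undefined.\<close>
  define f where "f i = (if i \<in> ?D then Some (g (nm i) i) else None)" for i
  have off: "g (nm i) i \<in> offer_positions w (nm i)" if "i \<in> ?D" for i
    using g(1) nm(2)[OF that] by blast
  have comp: "w ! i \<bowtie> w ! j" if "f i = Some j" for i j
  proof -
    have "i \<in> ?D" "j = g (nm i) i" using that by (auto simp: f_def split: if_splits)
    then show ?thesis
      using off complementary_request_iff[OF nm(1)] by (auto simp: offer_positions_def)
  qed
  have "inj_on f ?D"
  proof (rule inj_onI)
    fix i j assume ij: "i \<in> ?D" "j \<in> ?D" and "f i = f j"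
    then have eq: "g (nm i) i = g (nm j) j" by (simp add: f_def)
    \<comment> \<open>A common image is an offer on both names, hence the names agree, and
      injectivity of \<open>g\<close> for that single name applies.\<close>
    have "offer_on (w ! g (nm i) i) (Off (nm i))" "offer_on (w ! g (nm i) i) (Off (nm j))"
      using off[OF ij(1)] off[OF ij(2)] eq by (auto simp: offer_positions_def)
    then have "nm i = nm j" by (auto dest!: filter_offer)
    then show "i = j" using eq g(2) nm(2)[OF ij(1)] nm(2)[OF ij(2)] by (metis inj_onD)
  qed
  moreover have "dom f = ?D" by (auto simp: f_def split: if_splits)
  moreover have "ran f \<subseteq> {..<length w}"
    using off by (auto simp: f_def ran_def offer_positions_def split: if_splits)
  ultimately show "w \<in> weak_agreement r"
    unfolding weak_agreement_def using assms comp by (auto intro!: exI[of _ f])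
qed

section \<open>The surplus of offers along a run\<close>

lemma sum_count_mset:
  fixes c :: "'a \<Rightarrow> real"
  assumes "finite T" "set p \<subseteq> T"
  shows "(\<Sum>t \<in> T. c t * real (count (mset p) t)) = (\<Sum>t \<leftarrow> p. c t)"
  using assms(2)
proof (induction p)
  case (Cons e p)
  have "(\<Sum>t \<in> T. c t * real (count (mset (e # p)) t)) =
      (\<Sum>t \<in> T. c t * real (count (mset p) t) + (if t = e then c t else 0))"
    by (intro sum.cong) (auto simp: algebra_simps)
  then show ?case using Cons assms(1) by (simp add: sum.distrib)
qed simp

text \<open>Each transition contributes 1, -1 or 0 according to its observable; a match is observed
  as \<open>Tau\<close> and so leaves the surplus unchanged.\<close>

lemma coefficient_sum_list:
  assumes "\<forall>t \<in> set p. is_request (fst (snd t)) \<or> is_offer (fst (snd t)) \<or> is_match (fst (snd t))"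
  shows "(\<Sum>t \<leftarrow> p. coefficient (Req n) t) =
    real (card (offer_positions (map (fst \<circ> snd) p) n))
      - real (card (request_positions (map (fst \<circ> snd) p) n))"
proof -
  have "card (offer_positions w n) = length (filter (\<lambda>v. offer_on v (Off n)) w)"
    "card (request_positions w n) = length (filter (\<lambda>v. request_on v (Req n)) w)" for w
    by (simp_all add: offer_positions_def request_positions_def length_filter_conv_card)
  moreover have "(\<Sum>t \<leftarrow> p. coefficient (Req n) t) =
      real (length (filter (\<lambda>v. offer_on v (Off n)) (map (fst \<circ> snd) p)))
      - real (length (filter (\<lambda>v. request_on v (Req n)) (map (fst \<circ> snd) p)))"
    using assms
  proof (induction p)
    case (Cons t p)
    have "coefficient (Req n) t = of_bool (offer_on (fst (snd t)) (Off n)) - of_bool (request_on (fst (snd t)) (Req n))"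
      using Cons.prems observable_Req_iff[of "fst (snd t)" n] observable_Off_iff[of "fst (snd t)" n]
        request_not_offer[of "fst (snd t)"]
      by (auto simp: coefficient_def split: prod.splits)
    then show ?case using Cons by simp
  qed simp
  ultimately show ?thesis by simp
qed

section \<open>The optimisation problem\<close>

text \<open>A sum of zeros and ones counts the ones, so exactly one index is selected.\<close>

lemma zero_one_sum_eq_1:
  fixes v :: "'a \<Rightarrow> real"
  assumes "finite I" "\<forall>i \<in> I. v i \<in> {0, 1}" "sum v I = 1"
  obtains k where "k \<in> I" "\<And>i. i \<in> I \<Longrightarrow> v i = of_bool (i = k)"
proof -
  have "sum v I = real (card {i \<in> I. v i = 1})"
  proof -
    have "sum v I = (\<Sum>i \<in> I. if v i = 1 then 1 else 0)"
      using assms(2) by (intro sum.cong) auto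
    then show ?thesis using assms(1) by (simp add: sum.inter_filter[symmetric])
  qed
  then have "card {i \<in> I. v i = 1} = 1" using assms(3) by simp
  then obtain k where k: "{i \<in> I. v i = 1} = {k}" by (meson card_1_singletonE)
  show thesis
  proof (rule that)
    show "k \<in> I" using k by auto
    show "v i = of_bool (i = k)" if "i \<in> I" for i using that k assms(2) by (cases "i = k") auto
  qed
qed

text \<open>An infimum is nonnegative iff all its members are, so the minimum need not be attained.
  For \<open>l = 0\<close> there are no feasible points, the infimum is infinite, and both sides
  hold.\<close>

lemma optimal_value_nonneg_iff:
  "optimal_value A qf l a \<ge> 0 \<longleftrightarrow>
    (\<forall>i \<in> {1..l}. \<forall>x \<in> flows A (initial A) qf.
      (\<Sum>t \<in> transitions A. coefficient (a i) t * real (x t)) \<ge> 0)"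
    (is "_ \<longleftrightarrow> (\<forall>i \<in> _. \<forall>x \<in> _. ?S i x \<ge> 0)")
proof -
  have "(\<forall>v x \<gamma>. feasible A qf l a v x \<gamma> \<longrightarrow> \<gamma> \<ge> 0) \<longleftrightarrow>
    (\<forall>i \<in> {1..l}. \<forall>x \<in> flows A (initial A) qf. ?S i x \<ge> 0)"
  proof (intro iffI ballI allI impI)
    fix i x assume *: "\<forall>v x \<gamma>. feasible A qf l a v x \<gamma> \<longrightarrow> \<gamma> \<ge> 0" "i \<in> {1..l}" "x \<in> flows A (initial A) qf"
    \<comment> \<open>The indicator of \<open>i\<close> selects one request, and the surplus itself
      is the least \<open>\<gamma>\<close> allowed for it.\<close>
    then have "feasible A qf l a (\<lambda>j. of_bool (j = i)) x (?S i x)"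
      by (auto simp: feasible_def of_bool_def if_distrib[of "\<lambda>y. y * _"] cong: if_cong)
    then show "?S i x \<ge> 0" using * by blast
  next
    fix v x \<gamma>
    assume *: "\<forall>i \<in> {1..l}. \<forall>x \<in> flows A (initial A) qf. ?S i x \<ge> 0" "feasible A qf l a v x \<gamma>"
    then obtain k where k: "k \<in> {1..l}" "\<And>i. i \<in> {1..l} \<Longrightarrow> v i = of_bool (i = k)"
      using zero_one_sum_eq_1[of "{1..l}" v] by (auto simp: feasible_def)
    have "(\<Sum>i \<in> {1..l}. v i * ?S i x) = (\<Sum>i \<in> {1..l}. if i = k then ?S i x else 0)"
      using k(2) by (intro sum.cong) auto
    then have "(\<Sum>i \<in> {1..l}. v i * ?S i x) = ?S k x" using k(1) by simp
    then show "\<gamma> \<ge> 0" using * k(1) by (fastforce simp: feasible_def)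
  qed
  moreover have "optimal_value A qf l a \<ge> 0 \<longleftrightarrow> (\<forall>v x \<gamma>. feasible A qf l a v x \<gamma> \<longrightarrow> \<gamma> \<ge> 0)"
    unfolding optimal_value_def le_Inf_iff by (auto simp flip: ereal_less_eq(5))
  ultimately show ?thesis by simp
qed

text \<open>The condition \<open>rank A > 1\<close> is built into \<open>weak_agreement\<close>,
  which is empty for smaller ranks, while \<open>language A\<close> is nonempty in the flow
  setting.\<close>

theorem theorem4p12:
  fixes A :: "('q, 'n) ca" and qf :: "'q list" and l :: nat and a :: "nat \<Rightarrow> 'n action"
  assumes "flow_setting A qf l a"
    and "rank A > 1"
  shows "weakly_safe A \<longleftrightarrow> optimal_value A qf l a \<ge> 0"
proof -
  let ?s = "initial A" and ?T = "transitions A" and ?lab = "map (fst \<circ> snd)"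
  have CA: "contract_automaton A" and fin: "finals A = {qf}" "?s \<noteq> qf"
    and req: "requests A = a ` {1..l}"
    using assms(1) by (auto simp: flow_setting_def)
  have st: "?s \<in> states A" "qf \<in> states A" and Off: "offers A \<subseteq> Offers" and Req: "requests A \<subseteq> Requests"
    using CA fin by (auto simp: contract_automaton_def)
  have flows: "flows A ?s qf = {restrict (count (mset p)) ?T |p. walk ?s p qf \<and> set p \<subseteq> ?T}"
    using flows_imp_walk[OF CA st fin(2)] walk_in_flows[OF CA _ _ fin(2)] by blast
  have lang: "language A = {?lab p |p. walk ?s p qf \<and> set p \<subseteq> ?T}"
    unfolding language_def fin(1) using path_imp_walk walk_imp_path[OF st(2)] by fastforce
  have wa: "?lab p \<in> weak_agreement (rank A) \<longleftrightarrow>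
      (\<forall>i \<in> {1..l}. (\<Sum>t \<in> ?T. coefficient (a i) t * real (restrict (count (mset p)) ?T t)) \<ge> 0)"
    if p: "set p \<subseteq> ?T" for p
  proof -
    have len: "\<forall>v \<in> set (?lab p). length v = rank A"
      using p contract_automatonD(3)[OF CA] by auto
    have S: "(\<Sum>t \<in> ?T. coefficient (Req n) t * real (restrict (count (mset p)) ?T t)) =
        real (card (offer_positions (?lab p) n)) - real (card (request_positions (?lab p) n))" for n
    proof -
      have "\<forall>t \<in> set p. is_request (fst (snd t)) \<or> is_offer (fst (snd t)) \<or> is_match (fst (snd t))"
        using p contract_automatonD(5)[OF CA] by blast
      from coefficient_sum_list[OF this] sum_count_mset[OF finite_transitions[OF CA] p]
      show ?thesis by simp
    qed
    \<comment> \<open>Weak agreement quantifies over all names, the optimisation problem only over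
      \<open>requests A\<close>; other names never occur as requests, so their inequality is
      trivial.\<close>
    have "request_positions (?lab p) n = {}" if "Req n \<notin> requests A" for n
    proof (rule ccontr)
      assume "request_positions (?lab p) n \<noteq> {}"
      then obtain i where "i < length (?lab p)" "request_on (?lab p ! i) (Req n)"
        unfolding request_positions_def by blast
      then obtain v where v: "v \<in> set (?lab p)" "request_on v (Req n)"
        using nth_mem by blast
      then have "Req n \<in> set v" by (auto simp: request_on_def)
      moreover have "set v \<subseteq> requests A \<union> offers A \<union> {Idle}"
        using v(1) p contract_automatonD(4)[OF CA] by fastforce
      ultimately show False using that Off by auto
    qed
    then have "?lab p \<in> weak_agreement (rank A) \<longleftrightarrow> (\<forall>n. Req n \<in> requests A \<longrightarrow>
        card (request_positions (?lab p) n) \<le> card (offer_positions (?lab p) n))"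
      unfolding weak_agreement_iff[OF assms(2) len] by (metis card.empty zero_le)
    also have "\<dots> \<longleftrightarrow> (\<forall>\<alpha> \<in> requests A. (\<Sum>t \<in> ?T. coefficient \<alpha> t * real (restrict (count (mset p)) ?T t)) \<ge> 0)"
      using Req S by fastforce
    finally show ?thesis unfolding req by simp
  qed
  have "weakly_safe A \<longleftrightarrow> (\<forall>p. walk ?s p qf \<and> set p \<subseteq> ?T \<longrightarrow> ?lab p \<in> weak_agreement (rank A))"
    unfolding weakly_safe_def lang by blast
  \<comment> \<open>Accepted words and feasible flows are both parametrised by the same walks
    \<open>p\<close>, so \<open>wa\<close> can be applied walk by walk.\<close>
  also have "\<dots> \<longleftrightarrow> optimal_value A qf l a \<ge> 0"
    unfolding optimal_value_nonneg_iff flows using wa by blast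
  finally show ?thesis .
qed

end
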